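(* The combinatorial bigraph $H_{4,3}$ is gapless.
   Context: For positive integers $m<n$, the $(n,m)$-combinatorial bigraph $H_{n,m}$ has left vertices the $m$-element subsets of $[n]$, right vertices $[n]$, and an edge between a subset $S$ and $j\in[n]$ iff $j\in S$. General notions: a bigraph $H$ has left part $[N]$, right part $[M]$, neighborhoods $\mathcal N(\cdot)$; its base graph $G_H$ is the graph on $[N]$ where distinct $u,v$ are adjacent iff they share a neighbor. With Lebesgue measure $\mu$ on $[0,1]^M$, a family $\{A_1,\dots,A_N\}$ of measurable sets conforms with $H$ if each $A_i=B_i\times[0,1]^{[M]\setminus\mathcal N(i)}$ with $B_i\subseteq[0,1]^{\mathcal N(i)}$ measurable; $\mathcal I(H)$ is the set of $\vec p\in(0,1)^N$ such that $\mu(\bigcap_i([0,1]^M\setminus A_i))>0$ for every conforming family with $\mu(A_i)=p_i$. For a graph $G$ on $[N]$, $\mathcal I_a(G)$ is the set of $\vec p\in(0,1)^N$ such that for every probability space and events $A_1,\dots,A_N$ with $\Pr(A_i)=p_i$ for which $G$ is a dependency graph (each $A_i$ mutually independent of $\{A_j:j\ne i,j\notin\mathcal N_G(i)\}$), $\Pr(\bigcap_i\overline{A_i})>0$. $H$ is gapful if there are $\vec p\in(0,1)^N$, $\lambda>0$ with $\lambda\vec p\in\mathcal I(H)\setminus\mathcal I_a(G_H)$, and gapless otherwise. *)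

theory Defs
  imports "HOL-Probability.Probability"
begin

record ('a, 'b) bigraph =
  left :: "'a set"
  right :: "'b set"
  edges :: "('a \<times> 'b) set"

definition nbhd :: "('a, 'b) bigraph \<Rightarrow> 'a \<Rightarrow> 'b set" where
  "nbhd H u = {j \<in> right H. (u, j) \<in> edges H}"

definition comb_bigraph :: "nat \<Rightarrow> nat \<Rightarrow> (nat set, nat) bigraph" where
  "comb_bigraph n m =
     (let L = {S. S \<subseteq> {1..n} \<and> card S = m}
      in \<lparr> left = L, right = {1..n}, edges = {(S, j). S \<in> L \<and> j \<in> {1..n} \<and> j \<in> S} \<rparr>)"

record 'a graph =
  verts :: "'a set"
  adj :: "('a \<times> 'a) set"

definition base_graph :: "('a, 'b) bigraph \<Rightarrow> 'a graph" where
  "base_graph H =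
     \<lparr> verts = left H,
       adj = {(u, v). u \<in> left H \<and> v \<in> left H \<and> u \<noteq> v \<and> nbhd H u \<inter> nbhd H v \<noteq> {}} \<rparr>"

text \<open>Lebesgue measure on the cube \<open>[0,1]\<^sup>J\<close>, for a finite index set \<open>J\<close>. The product measure
  alone only knows the Borel sets; its completion has the Lebesgue measurable sets.\<close>

definition unit_cube :: "'b set \<Rightarrow> ('b \<Rightarrow> real) measure" where
  "unit_cube J = completion (\<Pi>\<^sub>M j\<in>J. restrict_space lborel {0..1})"

text \<open>\<open>prod_emb R _ K B\<close> is the cylinder \<open>B \<times> [0,1]\<^bsup>R - K\<^esup>\<close> over the base \<open>B \<subseteq> [0,1]\<^sup>K\<close>.\<close>

definition conforms :: "('a, 'b) bigraph \<Rightarrow> ('a \<Rightarrow> ('b \<Rightarrow> real) set) \<Rightarrow> bool" where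
  "conforms H A \<longleftrightarrow>
     (\<forall>i\<in>left H. A i \<in> sets (unit_cube (right H)) \<and>
        (\<exists>B\<in>sets (unit_cube (nbhd H i)).
           A i = prod_emb (right H) (\<lambda>_. restrict_space lborel {0..1}) (nbhd H i) B))"

text \<open>A vector indexed by a vertex set is a function of which only the values on that set matter.\<close>

definition bigraph_interior :: "('a, 'b) bigraph \<Rightarrow> ('a \<Rightarrow> real) set" where
  "bigraph_interior H =
     {p \<in> left H \<rightarrow> {0<..<1}.
        \<forall>A. conforms H A \<and> (\<forall>i\<in>left H. measure (unit_cube (right H)) (A i) = p i) \<longrightarrow>
          measure (unit_cube (right H)) {x \<in> space (unit_cube (right H)). \<forall>i\<in>left H. x \<notin> A i} > 0}"

text \<open>Mutual independence of an event from a family of events is independence from the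
  sigma-algebra that the family generates.\<close>

definition dependency_graph :: "'w measure \<Rightarrow> ('a \<Rightarrow> 'w set) \<Rightarrow> 'a graph \<Rightarrow> bool" where
  "dependency_graph M A G \<longleftrightarrow>
     (\<forall>i\<in>verts G.
        prob_space.indep_set M {A i}
          (sigma_sets (space M) (A ` {j \<in> verts G. j \<noteq> i \<and> (i, j) \<notin> adj G})))"

text \<open>HOL cannot quantify over all types inside a formula, so the type \<open>'w\<close> of sample points is a
  parameter. The probability spaces occur universally in membership in \<open>abstract_interior\<close>, hence
  also in \<open>gapless\<close>; a theorem asserting \<open>gapless TYPE('w) H\<close> for a type variable \<open>'w\<close>
  therefore covers all probability spaces.\<close>

definition abstract_interior :: "'w itself \<Rightarrow> 'a graph \<Rightarrow> ('a \<Rightarrow> real) set" where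
  "abstract_interior (_ :: 'w itself) G =
     {p \<in> verts G \<rightarrow> {0<..<1}.
        \<forall>(M :: 'w measure) A.
          prob_space M \<and> (\<forall>i\<in>verts G. A i \<in> sets M \<and> measure M (A i) = p i) \<and>
          dependency_graph M A G \<longrightarrow>
            measure M {\<omega> \<in> space M. \<forall>i\<in>verts G. \<omega> \<notin> A i} > 0}"

definition gapful :: "'w itself \<Rightarrow> ('a, 'b) bigraph \<Rightarrow> bool" where
  "gapful T H \<longleftrightarrow>
     (\<exists>p \<in> left H \<rightarrow> {0<..<1}. \<exists>l>0.
        (\<lambda>i. l * p i) \<in> bigraph_interior H - abstract_interior T (base_graph H))"

definition gapless :: "'w itself \<Rightarrow> ('a, 'b) bigraph \<Rightarrow> bool" where
  "gapless T H \<longleftrightarrow> \<not> gapful T H"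

end

theory Submission imports Defs begin

text \<open>
  The base graph of the bigraph is complete, so by the union bound its abstract interior contains
  every vector of sum less than 1. It remains to cover the cube by conforming sets of measures
  \<open>p\<^sub>i\<close> whenever the sum is at least 1; sets can be enlarged, so we may assume that the sum is 1.

  Round each coordinate to a bit by a threshold. Label the coordinates so that \<open>p\<^sub>a\<close> is
  minimal. For all bits \<open>a\<close>, \<open>b\<close>, \<open>c\<close>, \<open>d\<close>, exactly one of \<open>b = c = d\<close>, \<open>a = c = \<not> d\<close>,
  \<open>a = d = \<not> b\<close>, \<open>a = b = \<not> c\<close> holds: if \<open>b\<close>, \<open>c\<close>, \<open>d\<close> are not all equal, each of the bit
  changes \<open>1 \<rightarrow> 0\<close> and \<open>0 \<rightarrow> 1\<close> occurs once along the cycle \<open>b\<close>, \<open>c\<close>, \<open>d\<close>, and \<open>a\<close>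
  selects one of them. Each condition leaves out one coordinate, and the thresholds can be chosen
  so that the four measures are the prescribed ones.
\<close>

section \<open>Solving for the thresholds\<close>

text \<open>
  With the probabilities written as \<open>(1 \<plusminus> r) / 2\<close>, the last three equations become bilinear in
  the \<open>r\<close>'s; imposing \<open>z = 1 - y\<close> uses up the one spare degree of freedom and makes the system
  triangular. Minimality of \<open>pa\<close> keeps the solution in the unit interval.
\<close>
lemma threshold_equations:
  fixes pa pb pc pd :: real
  assumes sum1: "pa + pb + pc + pd = 1" and "0 \<le> pa"
    and le: "pa \<le> pb" "pa \<le> pc" "pa \<le> pd"
  obtains s x y z where "s \<in> {0..1}" "x \<in> {0..1}" "y \<in> {0..1}" "z \<in> {0..1}"
    and "x * y * z + (1 - x) * (1 - y) * (1 - z) = pa"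
    and "s * y * (1 - z) + (1 - s) * (1 - y) * z = pb"
    and "s * z * (1 - x) + (1 - s) * (1 - z) * x = pc"
    and "s * x * (1 - y) + (1 - s) * (1 - x) * y = pd"
proof -
  \<comment> \<open>With \<open>y = (1 - h) / 2\<close> and \<open>z = 1 - y\<close>, the first
    equation no longer contains \<open>x\<close>: it reads \<open>y * z = pa\<close>, that is
    \<open>h * h = 1 - 4 * pa\<close>.\<close>
  define h where "h = sqrt (1 - 4 * pa)"
  have pa4: "4 * pa \<le> 1"
    using sum1 le by linarith
  have h2: "h * h = 1 - 4 * pa" and h0: "0 \<le> h" and h1: "h \<le> 1"
    using pa4 \<open>0 \<le> pa\<close> by (auto simp: h_def real_le_lsqrt)
  \<comment> \<open>Adding the equations for \<open>pc\<close> and \<open>pd\<close> with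
    \<open>s = (1 + t) / 2\<close> eliminates \<open>x\<close> and leaves
    \<open>t * h = w\<close>.\<close>
  define w where "w = 2 * (pc + pd) - 1"
  obtain t where t: "t * h = w" "\<bar>t\<bar> \<le> 1"
  proof (cases "h = 0")
    case True
    then have "w = 0"
      using h2 sum1 le by (simp add: w_def)
    with True that[of 0] show ?thesis by simp
  next
    case False
    \<comment> \<open>This is \<open>w\<^sup>2 \<le> h\<^sup>2\<close> in disguise. Of the sums
      \<open>pa + pb\<close> and \<open>pc + pd\<close>, which add up to 1, one is at least 1/2, and
      the other is at least \<open>2 * pa\<close> by minimality.\<close>
    have "pa \<le> (pc + pd) * (1 - (pc + pd))"
    proof -
      have *: "pa \<le> u * v" if "u + v = 1" "u \<ge> 1/2" "v \<ge> 2 * pa" for u v :: real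
      proof -
        have "1/2 * (2 * pa) \<le> u * v"
          using that \<open>0 \<le> pa\<close> by (intro mult_mono) auto
        then show ?thesis by simp
      qed
      show ?thesis
      proof (cases "pc + pd \<ge> 1/2")
        case True
        then show ?thesis
          using *[of "pc + pd" "1 - (pc + pd)"] sum1 le by simp
      next
        case False
        then show ?thesis
          using *[of "1 - (pc + pd)" "pc + pd"] sum1 le by (simp add: mult.commute)
      qed
    qed
    then have "w\<^sup>2 \<le> h\<^sup>2"
      using h2 by (simp add: w_def power2_eq_square algebra_simps)
    then have "\<bar>w\<bar> \<le> h"
      using h0 by (simp add: abs_le_square_iff[symmetric])
    with False h0 that[of "w / h"] show ?thesis by (simp add: field_simps)
  qed
  \<comment> \<open>Subtracting the equations for \<open>pc\<close> and \<open>pd\<close> with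
    \<open>x = (1 - g) / 2\<close> leaves this linear equation for \<open>g\<close>. If
    \<open>h = 0\<close>, all four values are 1/4 and \<open>g = 0\<close> works.\<close>
  obtain g where g: "g * (h + t) = 2 * (pc - pd)" "\<bar>g\<bar> \<le> 1"
  proof (cases "h = 0")
    case True
    then have "pc = pd"
      using h2 sum1 le by simp
    with that[of 0] show ?thesis by simp
  next
    case False
    \<comment> \<open>The right side is at least \<open>2 * \<bar>pc - pd\<bar>\<close> because
      \<open>pa\<close> is minimal. As \<open>h \<le> 1\<close>, cancelling \<open>h\<close> yields
      the bound on \<open>g\<close>.\<close>
    have ht: "h * (h + t) = 2 * (pc - pa) + 2 * (pd - pa)"
      using h2 t by (simp add: w_def algebra_simps)
    have "h * (2 * \<bar>pc - pd\<bar>) \<le> 1 * (2 * \<bar>pc - pd\<bar>)"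
      using h1 by (intro mult_right_mono) auto
    also have "\<dots> \<le> h * (h + t)"
      unfolding ht using le by (simp add: abs_if)
    finally have le': "2 * \<bar>pc - pd\<bar> \<le> h + t"
      using h0 False by simp
    show ?thesis
    proof (cases "h + t = 0")
      case True
      then show ?thesis using le' that[of 0] by simp
    next
      case False
      moreover have "\<bar>2 * (pc - pd)\<bar> = 2 * \<bar>pc - pd\<bar>"
        by (simp add: abs_if)
      ultimately show ?thesis
        using le' by (intro that[of "2 * (pc - pd) / (h + t)"]) (auto simp: abs_divide)
    qed
  qed
  show ?thesis
  proof (rule that[of "(1 + t) / 2" "(1 - g) / 2" "(1 - h) / 2" "(1 + h) / 2"])
    show "(1 + t) / 2 \<in> {0..1}" "(1 - g) / 2 \<in> {0..1}" "(1 - h) / 2 \<in> {0..1}" "(1 + h) / 2 \<in> {0..1}"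
      using t g h0 h1 by auto
  next
    show "(1 - g) / 2 * ((1 - h) / 2) * ((1 + h) / 2) +
        (1 - (1 - g) / 2) * (1 - (1 - h) / 2) * (1 - (1 + h) / 2) = pa"
      using h2 by (simp add: field_simps)
  next
    show "(1 + t) / 2 * ((1 - h) / 2) * (1 - (1 + h) / 2) +
        (1 - (1 + t) / 2) * (1 - (1 - h) / 2) * ((1 + h) / 2) = pb"
      using h2 t sum1 by (simp add: w_def field_simps)
  next
    show "(1 + t) / 2 * ((1 + h) / 2) * (1 - (1 - g) / 2) +
        (1 - (1 + t) / 2) * (1 - (1 + h) / 2) * ((1 - g) / 2) = pc" (is "?lhs = _")
    proof -
      have "?lhs = (1 + t * h + g * (h + t)) / 4"
        by (simp add: field_simps)
      then show ?thesis
        unfolding t(1) g(1) by (simp add: w_def)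
    qed
  next
    show "(1 + t) / 2 * ((1 - g) / 2) * (1 - (1 - h) / 2) +
        (1 - (1 + t) / 2) * (1 - (1 - g) / 2) * ((1 - h) / 2) = pd" (is "?lhs = _")
    proof -
      have "?lhs = (1 + t * h - g * (h + t)) / 4"
        by (simp add: field_simps)
      then show ?thesis
        unfolding t(1) g(1) by (simp add: w_def)
    qed
  qed
qed

section \<open>Measures of sets in the cube\<close>

abbreviation unit_interval :: "real measure" where
  "unit_interval \<equiv> restrict_space lborel {0..1}"

lemma space_unit_interval: "space unit_interval = {0..1}"
  by (simp add: space_restrict_space)

lemma prob_space_unit_interval: "prob_space unit_interval"
  by (rule prob_spaceI) (simp add: space_restrict_space emeasure_restrict_space)

interpretation unit_interval: prob_space unit_interval
  by (rule prob_space_unit_interval)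

interpretation unit_interval_product: product_prob_space "\<lambda>_. unit_interval" J for J
  by unfold_locales

lemma measure_unit_interval_subset:
  "A \<in> sets borel \<Longrightarrow> A \<subseteq> {0..1} \<Longrightarrow> measure unit_interval A = measure lborel A"
  by (simp add: measure_restrict_space)

lemma Icc_in_unit_interval: "c \<le> 1 \<Longrightarrow> {0..c} \<in> sets unit_interval"
  by (auto simp: sets_restrict_space intro!: image_eqI[of _ _ "{0..c}"])

text \<open>The event that the bits \<open>x i \<in> E i\<close> are all equal. Replacing some
  \<open>E i\<close> by its complement flips that bit, so conditions such as
  \<open>a = c = \<not> d\<close> also take this form.\<close>

definition agree :: "'b set \<Rightarrow> ('b \<Rightarrow> real set) \<Rightarrow> ('b \<Rightarrow> real) set" where
  "agree K E = {x \<in> K \<rightarrow>\<^sub>E {0..1}. (\<forall>i\<in>K. x i \<in> E i) \<or> (\<forall>i\<in>K. x i \<notin> E i)}"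

lemma
  assumes K: "finite K" "K \<noteq> {}" and E: "\<And>i. i \<in> K \<Longrightarrow> E i \<in> sets unit_interval"
  shows sets_agree: "agree K E \<in> sets (\<Pi>\<^sub>M j\<in>K. unit_interval)"
    and measure_agree: "measure (\<Pi>\<^sub>M j\<in>K. unit_interval) (agree K E) =
      (\<Prod>i\<in>K. measure unit_interval (E i)) + (\<Prod>i\<in>K. 1 - measure unit_interval (E i))"
proof -
  interpret finite_product_prob_space "\<lambda>_. unit_interval" K
    by unfold_locales (rule K)
  have sub: "E i \<subseteq> {0..1}" if "i \<in> K" for i
    using sets.sets_into_space[OF E[OF that]] by (simp add: space_unit_interval)
  have eq: "agree K E = (\<Pi>\<^sub>E i\<in>K. E i) \<union> (\<Pi>\<^sub>E i\<in>K. {0..1} - E i)"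
    unfolding agree_def PiE_def using sub by (fastforce simp: Pi_iff)
  have E': "{0..1} - E i \<in> sets unit_interval" if "i \<in> K" for i
    using sets.compl_sets[OF E[OF that]] by (simp add: space_unit_interval)
  have meas: "(\<Pi>\<^sub>E i\<in>K. E i) \<in> sets (\<Pi>\<^sub>M j\<in>K. unit_interval)"
    "(\<Pi>\<^sub>E i\<in>K. {0..1} - E i) \<in> sets (\<Pi>\<^sub>M j\<in>K. unit_interval)"
    using E E' K by (auto intro!: sets_PiM_I_finite)
  then show "agree K E \<in> sets (\<Pi>\<^sub>M j\<in>K. unit_interval)"
    unfolding eq by blast
  have compl: "measure unit_interval ({0..1} - E i) = 1 - measure unit_interval (E i)" if "i \<in> K" for i
    using unit_interval.prob_compl[OF E[OF that]] by (simp add: space_unit_interval)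
  \<comment> \<open>Disjointness rests on \<open>K \<noteq> {}\<close>: over the empty index set
    both boxes are the same one-point space.\<close>
  have "(\<Pi>\<^sub>E i\<in>K. E i) \<inter> (\<Pi>\<^sub>E i\<in>K. {0..1} - E i) = {}"
    using K by (auto simp: PiE_iff)
  then show "measure (\<Pi>\<^sub>M j\<in>K. unit_interval) (agree K E) =
      (\<Prod>i\<in>K. measure unit_interval (E i)) + (\<Prod>i\<in>K. 1 - measure unit_interval (E i))"
    unfolding eq using meas E E' compl
    by (simp add: unit_interval_product.finite_measure_Union prob_times)
qed

text \<open>Adjoin to \<open>B\<close> the slab on which one fixed coordinate is at most
  \<open>c\<close>. The measure of the union varies continuously with \<open>c\<close>, from that of
  \<open>B\<close> to 1, so it attains \<open>t\<close>.\<close>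

lemma enlarge_cube_set:
  assumes K: "finite K" "K \<noteq> {}" and B: "B \<in> sets (\<Pi>\<^sub>M j\<in>K. unit_interval)"
    and t: "measure (\<Pi>\<^sub>M j\<in>K. unit_interval) B \<le> t" "t \<le> 1"
  obtains B' where "B' \<in> sets (\<Pi>\<^sub>M j\<in>K. unit_interval)" "B \<subseteq> B'"
    and "measure (\<Pi>\<^sub>M j\<in>K. unit_interval) B' = t"
proof -
  let ?P = "\<Pi>\<^sub>M j\<in>K. unit_interval"
  obtain j where j: "j \<in> K" using K by blast
  let ?slab = "\<lambda>S. {x \<in> space ?P. x j \<in> S}"
  let ?g = "\<lambda>c. measure ?P (B \<union> ?slab {0..c})"
  have slab: "?slab S \<in> sets ?P" and measure_slab: "measure ?P (?slab S) = measure lborel S"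
    if "S \<in> sets borel" "S \<subseteq> {0..1}" for S
  proof -
    have S: "S \<in> sets unit_interval"
      using that by (auto simp: sets_restrict_space intro!: image_eqI[of _ _ S])
    then show "?slab S \<in> sets ?P"
      using measurable_sets[OF measurable_component_singleton[OF j, of "\<lambda>_. unit_interval"] S]
      by (simp add: vimage_def Int_def conj_commute)
    show "measure ?P (?slab S) = measure lborel S"
      using unit_interval_product.emeasure_PiM_Collect_single[OF j S]
        measure_unit_interval_subset[OF that] by (simp add: measure_def)
  qed
  have mono: "?g c \<le> ?g d" if "c \<le> d" "d \<le> 1" for c d
    using that B by (intro unit_interval_product.finite_measure_mono sets.Un slab) auto
  \<comment> \<open>Passing from \<open>c\<close> to \<open>d\<close> adds at most a slab of measure
    \<open>d - c\<close>. Together with monotonicity this makes \<open>?g\<close>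
    1-Lipschitz.\<close>
  have lip: "?g d - ?g c \<le> d - c" if "0 \<le> c" "c \<le> d" "d \<le> 1" for c d
  proof -
    have "?g d \<le> measure ?P ((B \<union> ?slab {0..c}) \<union> ?slab {c<..d})"
      using B that by (intro unit_interval_product.finite_measure_mono sets.Un slab) auto
    also have "\<dots> \<le> ?g c + measure ?P (?slab {c<..d})"
      using B that by (intro measure_Un_le sets.Un slab) auto
    also have "measure ?P (?slab {c<..d}) = d - c"
      using that by (subst measure_slab) auto
    finally show ?thesis by simp
  qed
  have "\<exists>c\<ge>0. c \<le> 1 \<and> ?g c = t"
  proof (rule IVT')
    have "?g 0 \<le> measure ?P B + measure ?P (?slab {0..0})"
      using B by (intro measure_Un_le slab) auto
    then show "?g 0 \<le> t"
      using measure_slab[of "{0..0}"] t by simp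
    have "measure ?P (?slab {0..1}) \<le> ?g 1"
      using B by (intro unit_interval_product.finite_measure_mono sets.Un slab) auto
    then show "t \<le> ?g 1"
      using measure_slab[of "{0..1}"] t by simp
    have "1-lipschitz_on {0..1} ?g"
    proof (rule lipschitz_onI)
      fix c d :: real assume "c \<in> {0..1}" "d \<in> {0..1}"
      then show "dist (?g c) (?g d) \<le> 1 * dist c d"
        using mono[of c d] mono[of d c] lip[of c d] lip[of d c]
        by (cases "c \<le> d") (auto simp: dist_real_def)
    qed simp
    then show "continuous_on {0..1} ?g"
      by (rule lipschitz_on_continuous_on)
  qed simp
  then obtain c where "0 \<le> c" "c \<le> 1" "?g c = t"
    by blast
  then show ?thesis
    using that[of "B \<union> ?slab {0..c}"] B slab[of "{0..c}"] by auto
qed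

section \<open>Covering the cube by four cylinders\<close>

lemma cube_cover:
  assumes dist: "distinct [a, b, c, d]" and R: "R = {a, b, c, d}"
    and p: "\<And>i. i \<in> R \<Longrightarrow> p i \<ge> 0" "(\<Sum>i\<in>R. p i) = 1" and min: "\<And>i. i \<in> R \<Longrightarrow> p a \<le> p i"
  obtains B where "\<And>i. i \<in> R \<Longrightarrow> B i \<in> sets (\<Pi>\<^sub>M j\<in>R - {i}. unit_interval)"
    and "\<And>i. i \<in> R \<Longrightarrow> measure (\<Pi>\<^sub>M j\<in>R - {i}. unit_interval) (B i) = p i"
    and "\<And>x. x \<in> R \<rightarrow>\<^sub>E {0..1} \<Longrightarrow> \<exists>i\<in>R. restrict x (R - {i}) \<in> B i"
proof -
  obtain s x y z where in01: "s \<in> {0..1}" "x \<in> {0..1}" "y \<in> {0..1}" "z \<in> {0..1}"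
    and eqs: "x * y * z + (1 - x) * (1 - y) * (1 - z) = p a"
    "s * y * (1 - z) + (1 - s) * (1 - y) * z = p b"
    "s * z * (1 - x) + (1 - s) * (1 - z) * x = p c"
    "s * x * (1 - y) + (1 - s) * (1 - x) * y = p d"
    by (rule threshold_equations[of "p a" "p b" "p c" "p d"]) (use dist R p min in auto)
  define E :: "'a \<Rightarrow> real set" where "E = (\<lambda>i. {0..if i = a then s else if i = b then x else if i = c then y else z})"
  \<comment> \<open>Agreement of \<open>F i\<close> over \<open>R - {i}\<close> is the condition
    that leaves out \<open>i\<close>; the set complemented in \<open>F i\<close> belongs to its
    negated bit.\<close>
  define F where "F = (\<lambda>i. if i = a then E else if i = b then E(d := {0..1} - E d)
    else if i = c then E(b := {0..1} - E b) else E(c := {0..1} - E c))"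
  have E: "E i \<in> sets unit_interval" for i
    using in01 by (auto simp: E_def intro!: Icc_in_unit_interval)
  have E': "{0..1} - E i \<in> sets unit_interval" for i
    using sets.compl_sets[OF E] by (simp add: space_unit_interval)
  have F: "F i j \<in> sets unit_interval" for i j
    using E E' by (auto simp: F_def)
  have mE: "measure unit_interval (E a) = s" "measure unit_interval (E b) = x"
    "measure unit_interval (E c) = y" "measure unit_interval (E d) = z"
    using in01 dist by (auto simp: E_def measure_unit_interval_subset)
  have mE': "measure unit_interval ({0..1} - E i) = 1 - measure unit_interval (E i)" for i
    using unit_interval.prob_compl[OF E] by (simp add: space_unit_interval)
  have neq: "b \<noteq> a" "c \<noteq> a" "d \<noteq> a" "c \<noteq> b" "d \<noteq> b" "d \<noteq> c"
    using dist by auto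
  have Rm: "R - {a} = {b, c, d}" "R - {b} = {a, c, d}" "R - {c} = {a, b, d}" "R - {d} = {a, b, c}"
    using dist by (auto simp: R)
  show ?thesis
  proof (rule that[of "\<lambda>i. agree (R - {i}) (F i)"])
    fix i assume i: "i \<in> R"
    then have ne: "R - {i} \<noteq> {}" "finite (R - {i})"
      using dist by (auto simp: R)
    show "agree (R - {i}) (F i) \<in> sets (\<Pi>\<^sub>M j\<in>R - {i}. unit_interval)"
      using ne F by (intro sets_agree)
    have "measure (\<Pi>\<^sub>M j\<in>R - {i}. unit_interval) (agree (R - {i}) (F i)) =
      (\<Prod>j\<in>R - {i}. measure unit_interval (F i j)) + (\<Prod>j\<in>R - {i}. 1 - measure unit_interval (F i j))"
      using ne F by (intro measure_agree)
    also have "\<dots> = p i"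
      using i unfolding R insert_iff empty_iff
      by (elim disjE) (use neq neq[symmetric] eqs in \<open>simp_all add: Rm F_def mE mE' R[symmetric] algebra_simps\<close>)
    finally show "measure (\<Pi>\<^sub>M j\<in>R - {i}. unit_interval) (agree (R - {i}) (F i)) = p i" .
  next
    fix v assume v: "v \<in> R \<rightarrow>\<^sub>E {0..1::real}"
    \<comment> \<open>Inside the unit interval, avoiding \<open>{0..1} - E j\<close> is the same as
      lying in \<open>E j\<close>, so complementing a set really flips the bit.\<close>
    then have v01: "v a \<in> {0..1}" "v b \<in> {0..1}" "v c \<in> {0..1}" "v d \<in> {0..1}"
      by (auto simp: R PiE_iff)
    have "restrict v (R - {i}) \<in> (R - {i}) \<rightarrow>\<^sub>E {0..1}" for i
      using v by (auto simp: PiE_iff)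
    moreover have "\<exists>i\<in>R. (\<forall>j\<in>R - {i}. v j \<in> F i j) \<or> (\<forall>j\<in>R - {i}. v j \<notin> F i j)"
    proof -
      \<comment> \<open>The propositional identity on the four bits \<open>v j \<in> E j\<close>;
        its disjuncts leave out \<open>a\<close>, \<open>b\<close>, \<open>c\<close>,
        \<open>d\<close> in this order.\<close>
      have "(v b \<in> E b \<longleftrightarrow> v c \<in> E c) \<and> (v c \<in> E c \<longleftrightarrow> v d \<in> E d) \<or>
        (v a \<in> E a \<longleftrightarrow> v c \<in> E c) \<and> (v c \<in> E c \<longleftrightarrow> v d \<notin> E d) \<or>
        (v a \<in> E a \<longleftrightarrow> v d \<in> E d) \<and> (v d \<in> E d \<longleftrightarrow> v b \<notin> E b) \<or>
        (v a \<in> E a \<longleftrightarrow> v b \<in> E b) \<and> (v b \<in> E b \<longleftrightarrow> v c \<notin> E c)"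
        by argo
      then consider "v b \<in> E b \<longleftrightarrow> v c \<in> E c" "v c \<in> E c \<longleftrightarrow> v d \<in> E d"
        | "v a \<in> E a \<longleftrightarrow> v c \<in> E c" "v c \<in> E c \<longleftrightarrow> v d \<notin> E d"
        | "v a \<in> E a \<longleftrightarrow> v d \<in> E d" "v d \<in> E d \<longleftrightarrow> v b \<notin> E b"
        | "v a \<in> E a \<longleftrightarrow> v b \<in> E b" "v b \<in> E b \<longleftrightarrow> v c \<notin> E c"
        by blast
      then show ?thesis
      proof cases
        case 1
        then show ?thesis
          using neq neq[symmetric] v01 by (intro bexI[of _ a]) (auto simp: Rm F_def R)
      next
        case 2
        then show ?thesis
          using neq neq[symmetric] v01 by (intro bexI[of _ b]) (auto simp: Rm F_def R)
      next
        case 3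
        then show ?thesis
          using neq neq[symmetric] v01 by (intro bexI[of _ c]) (auto simp: Rm F_def R)
      next
        case 4
        then show ?thesis
          using neq neq[symmetric] v01 by (intro bexI[of _ d]) (auto simp: Rm F_def R)
      qed
    qed
    ultimately show "\<exists>i\<in>R. restrict v (R - {i}) \<in> agree (R - {i}) (F i)"
      by (auto simp: agree_def)
  qed
qed

section \<open>The combinatorial bigraph and the two interiors\<close>

text \<open>Lets a left vertex be named by the one coordinate that it misses. For
  \<open>n = 0\<close> truncated subtraction would leave the empty set as a left vertex, with no
  coordinate to name it.\<close>

lemma left_comb_bigraph_pred:
  assumes "0 < n"
  shows "left (comb_bigraph n (n - 1)) = (\<lambda>i. {1..n} - {i}) ` {1..n}"
proof (intro equalityI subsetI)
  fix S assume "S \<in> left (comb_bigraph n (n - 1))"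
  then have S: "S \<subseteq> {1..n}" "card S = n - 1"
    by (auto simp: comb_bigraph_def)
  then have "card ({1..n} - S) = 1"
    using assms by (subst card_Diff_subset) (auto intro: finite_subset)
  then obtain i where i: "{1..n} - S = {i}"
    by (auto simp: card_1_singleton_iff)
  then have "S = {1..n} - {i}" "i \<in> {1..n}"
    using S by auto
  then show "S \<in> (\<lambda>i. {1..n} - {i}) ` {1..n}"
    by blast
qed (auto simp: comb_bigraph_def)

lemma nbhd_comb_bigraph: "S \<in> left (comb_bigraph n m) \<Longrightarrow> nbhd (comb_bigraph n m) S = S"
  by (auto simp: comb_bigraph_def nbhd_def)

lemma right_comb_bigraph: "right (comb_bigraph n m) = {1..n}"
  by (simp add: comb_bigraph_def Let_def)

text \<open>By the union bound the events leave a set of positive measure uncovered, whatever the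
  graph is.\<close>

lemma abstract_interior_sum_less_1:
  assumes "finite (verts G)" "p \<in> verts G \<rightarrow> {0<..<1}" "(\<Sum>i\<in>verts G. p i) < 1"
  shows "p \<in> abstract_interior TYPE('w) G"
  unfolding abstract_interior_def
proof (intro CollectI conjI allI impI)
  fix M :: "'w measure" and A
  assume asm: "prob_space M \<and> (\<forall>i\<in>verts G. A i \<in> sets M \<and> measure M (A i) = p i) \<and> dependency_graph M A G"
  interpret prob_space M using asm by blast
  have A: "A ` verts G \<subseteq> sets M" using asm by blast
  have "measure M (\<Union>(A ` verts G)) \<le> (\<Sum>i\<in>verts G. measure M (A i))"
    using assms A by (intro finite_measure_subadditive_finite) auto
  also have "\<dots> < 1" using asm assms by simp
  finally have "measure M (space M - \<Union>(A ` verts G)) > 0"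
    using A assms by (subst prob_compl) auto
  also have "space M - \<Union>(A ` verts G) = {\<omega> \<in> space M. \<forall>i\<in>verts G. \<omega> \<notin> A i}" by auto
  finally show "measure M {\<omega> \<in> space M. \<forall>i\<in>verts G. \<omega> \<notin> A i} > 0" .
qed (use assms in auto)

text \<open>Otherwise, scaling \<open>q\<close> down to sum 1 gives a cover of the cube, and
  enlarging its members to the measures \<open>q\<close> gives a conforming family that leaves
  nothing uncovered.\<close>

lemma bigraph_interior_4_3_sum_less_1:
  assumes "q \<in> bigraph_interior (comb_bigraph 4 3)"
  shows "(\<Sum>S\<in>left (comb_bigraph 4 3). q S) < 1"
proof (rule ccontr)
  let ?H = "comb_bigraph 4 3" and ?R = "{1..4::nat}"
  let ?P = "\<lambda>J. \<Pi>\<^sub>M j\<in>J. unit_interval"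
  assume "\<not> ?thesis"
  then have ge1: "(\<Sum>S\<in>left ?H. q S) \<ge> 1" by simp
  have left: "left ?H = (\<lambda>i. ?R - {i}) ` ?R"
    using left_comb_bigraph_pred[of 4] by simp
  have q01: "0 < q (?R - {i})" "q (?R - {i}) < 1" if "i \<in> ?R" for i
    using assms that by (auto simp: bigraph_interior_def left Pi_iff)
  define total where "total = (\<Sum>i\<in>?R. q (?R - {i}))"
  have "inj_on (\<lambda>i. ?R - {i}) ?R"
    by (auto simp: inj_on_def)
  then have total_ge: "total \<ge> 1"
    using ge1 by (simp add: left sum.reindex total_def)
  \<comment> \<open>Dividing by \<open>total \<ge> 1\<close> gives sum 1 and keeps
    \<open>p i\<close> below the target measure, which leaves room for the enlargement.\<close>
  define p where "p i = q (?R - {i}) / total" for i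
  have sum_p: "(\<Sum>i\<in>?R. p i) = 1"
    using total_ge by (simp add: p_def total_def flip: sum_divide_distrib)
  have p0: "0 \<le> p i" and pq: "p i \<le> q (?R - {i})" if "i \<in> ?R" for i
    using q01[OF that] total_ge by (auto simp: p_def divide_le_eq mult_le_cancel_left1)
  obtain a where a: "a \<in> ?R" "\<And>i. i \<in> ?R \<Longrightarrow> p a \<le> p i"
    using ex_min_if_finite[of "p ` ?R"] by (force simp: not_less)
  have "card (?R - {a}) = 3" using a by simp
  then obtain b c d where "?R - {a} = {b, c, d}" "b \<noteq> c" "b \<noteq> d" "c \<noteq> d"
    by (auto simp: card_3_iff)
  then have R: "?R = {a, b, c, d}" "distinct [a, b, c, d]"
    using a by auto
  obtain B where B: "\<And>i. i \<in> ?R \<Longrightarrow> B i \<in> sets (?P (?R - {i}))"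
    "\<And>i. i \<in> ?R \<Longrightarrow> measure (?P (?R - {i})) (B i) = p i"
    "\<And>x. x \<in> ?R \<rightarrow>\<^sub>E {0..1} \<Longrightarrow> \<exists>i\<in>?R. restrict x (?R - {i}) \<in> B i"
    by (rule cube_cover[OF R(2,1) p0 sum_p a(2)]) auto
  have "\<exists>C. C \<in> sets (?P (?R - {i})) \<and> B i \<subseteq> C \<and> measure (?P (?R - {i})) C = q (?R - {i})"
    if "i \<in> ?R" for i
  proof (rule enlarge_cube_set[of "?R - {i}" "B i" "q (?R - {i})"])
    have "card (?R - {i}) = 3"
      using that by simp
    then show "?R - {i} \<noteq> {}"
      by (metis card.empty zero_neq_numeral)
  qed (use B pq q01 that in \<open>auto intro: less_imp_le\<close>)
  then obtain C where C: "\<And>i. i \<in> ?R \<Longrightarrow> C i \<in> sets (?P (?R - {i}))"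
    "\<And>i. i \<in> ?R \<Longrightarrow> B i \<subseteq> C i"
    "\<And>i. i \<in> ?R \<Longrightarrow> measure (?P (?R - {i})) (C i) = q (?R - {i})"
    by metis
  \<comment> \<open>A conforming family is indexed by left vertices, whereas \<open>C\<close> is
    indexed by the missing coordinate; \<open>the_elem\<close> recovers that coordinate from
    \<open>S\<close>.\<close>
  define A where "A S = prod_emb ?R (\<lambda>_. unit_interval) S (C (the_elem (?R - S)))" for S
  have the: "the_elem (?R - (?R - {i})) = i" if "i \<in> ?R" for i
    using that by (simp add: double_diff)
  have A: "A (?R - {i}) = prod_emb ?R (\<lambda>_. unit_interval) (?R - {i}) (C i)" if "i \<in> ?R" for i
    using the[OF that] by (simp add: A_def)
  have sets_A: "A (?R - {i}) \<in> sets (?P ?R)" if "i \<in> ?R" for i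
    unfolding A[OF that] using C(1)[OF that] by (intro measurable_prod_emb) auto
  have "conforms ?H A"
    unfolding conforms_def
  proof
    fix S assume S: "S \<in> left ?H"
    then obtain i where i: "i \<in> ?R" "S = ?R - {i}" by (auto simp: left)
    show "A S \<in> sets (unit_cube (right ?H)) \<and>
        (\<exists>B\<in>sets (unit_cube (nbhd ?H S)).
           A S = prod_emb (right ?H) (\<lambda>_. unit_interval) (nbhd ?H S) B)"
      \<comment> \<open>The sets built so far are measurable for the product measure, hence also for
        the completion in \<open>unit_cube\<close>.\<close>
      unfolding nbhd_comb_bigraph[OF S] right_comb_bigraph unit_cube_def
      using sets_A[OF i(1)] A[OF i(1)] C(1)[OF i(1)] i(2) by (auto intro: sets_completionI_sets)
  qed
  moreover have "\<forall>S\<in>left ?H. measure (unit_cube (right ?H)) (A S) = q S"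
  proof
    fix S assume S: "S \<in> left ?H"
    obtain i where i: "i \<in> ?R" "S = ?R - {i}" using S by (auto simp: left)
    have "measure (?P ?R) (A (?R - {i})) = measure (?P (?R - {i})) (C i)"
      unfolding A[OF i(1)] measure_def
      using C(1)[OF i(1)] by (subst unit_interval_product.emeasure_PiM_emb') auto
    then show "measure (unit_cube (right ?H)) (A S) = q S"
      using C(3)[OF i(1)] sets_A[OF i(1)]
      by (simp add: i(2) right_comb_bigraph unit_cube_def measure_completion)
  qed
  ultimately have "measure (unit_cube (right ?H))
      {x \<in> space (unit_cube (right ?H)). \<forall>S\<in>left ?H. x \<notin> A S} > 0"
    using assms unfolding bigraph_interior_def by blast
  moreover have "{x \<in> space (unit_cube (right ?H)). \<forall>S\<in>left ?H. x \<notin> A S} = {}"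
  proof -
    have "\<exists>i\<in>?R. x \<in> A (?R - {i})" if "x \<in> ?R \<rightarrow>\<^sub>E {0..1::real}" for x
    proof -
      obtain i where i: "i \<in> ?R" "restrict x (?R - {i}) \<in> B i"
        using B(3) \<open>x \<in> ?R \<rightarrow>\<^sub>E {0..1}\<close> by blast
      then have "x \<in> A (?R - {i})"
        using C(2)[OF i(1)] that unfolding A[OF i(1)]
        by (auto simp: prod_emb_iff space_unit_interval PiE_iff)
      with i show ?thesis by blast
    qed
    then show ?thesis
      by (auto simp: unit_cube_def right_comb_bigraph left space_PiM space_unit_interval)
  qed
  ultimately show False
    by (simp only: measure_empty less_irrefl)
qed

theorem theorem15: "gapless TYPE('w) (comb_bigraph 4 3)"
  unfolding gapless_def gapful_def
proof clarify
  fix p :: "nat set \<Rightarrow> real" and l :: real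
  let ?H = "comb_bigraph 4 3" and ?q = "\<lambda>S. l * p S"
  assume q: "?q \<in> bigraph_interior ?H" and not_in: "?q \<notin> abstract_interior TYPE('w) (base_graph ?H)"
  have verts: "verts (base_graph ?H) = left ?H"
    by (simp add: base_graph_def)
  have "finite (left ?H)"
    by (simp add: comb_bigraph_def)
  \<comment> \<open>Membership in the bigraph interior forces sum below 1, which suffices for the
    abstract interior, so the difference of the two is empty.\<close>
  then show False
    using abstract_interior_sum_less_1[of "base_graph ?H" ?q]
      bigraph_interior_4_3_sum_less_1[OF q] q not_in
    by (auto simp: verts bigraph_interior_def)
qed

end
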